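(* Let $Q$ be an extra loop. Then for all $x,y,z\in Q$: (1) $L(x,y)=R(x,y)=L(y,x)=R(y,x)$ and $L(x,y)^2=I$, where $I$ is the identity permutation of $Q$. (2) $(x,y,z)=[x,y,z]$ and $(x,y,z)^2=1$, so that the subgroup of the nucleus $N(Q)$ generated by the associators is a boolean group. (3) The associator $(x,y,z)$ commutes with $x$, with $y$, and with $z$.
   Context: A loop is a set $Q$ with a binary operation having a two-sided identity $1$ such that all equations $xu=y$ and $vx=y$ have unique solutions $u=x\backslash y$ and $v=y/x$. Here $x\cdot yz$ means $x(yz)$ and $xy\cdot z$ means $(xy)z$. A loop $Q$ is conjugacy closed (a CC-loop) if there are functions $f,g:Q\times Q\to Q$ such that for all $x,y,z\in Q$: $x\cdot yz=f(x,y)\cdot xz$ and $zy\cdot x=zx\cdot g(x,y)$. An extra loop is a CC-loop which is diassociative, i.e. every subloop $\langle x,y\rangle$ generated by two elements is a group (for CC-loops this is equivalent to being Moufang). The nucleus $N(Q)$ is the set of $a\in Q$ such that for all $x,y\in Q$: $a\cdot xy=ax\cdot y$, $xa\cdot y=x\cdot ay$ and $x\cdot ya=xy\cdot a$; it is a group, and in a CC-loop it contains all associators. Associators: $(x,y,z):=(x\cdot yz)\backslash(xy\cdot z)$ and $[x,y,z]:=(x\cdot yz)/(xy\cdot z)$. Permutations act on the right and are composed from left to right; translations are given by $xR_y=xy=yL_x$, and $R(x,y):=R_xR_yR_{xy}^{-1}$, $L(x,y):=L_xL_yL_{yx}^{-1}$. A boolean group is a group in which every element satisfies $u^2=1$.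 *)

theory Defs
  imports "HOL-Algebra.Generated_Groups" "HOL-Algebra.Bij"
begin

text \<open>Loops are carried by the record type of monoids from \<^theory>\<open>HOL-Algebra.Group\<close>, without
  its associativity axiom.\<close>

locale loop =
  fixes Q (structure)
  assumes loop_closed: "\<lbrakk>x \<in> carrier Q; y \<in> carrier Q\<rbrakk> \<Longrightarrow> x \<otimes> y \<in> carrier Q"
    and loop_one_closed: "\<one> \<in> carrier Q"
    and loop_l_one: "x \<in> carrier Q \<Longrightarrow> \<one> \<otimes> x = x"
    and loop_r_one: "x \<in> carrier Q \<Longrightarrow> x \<otimes> \<one> = x"
    and loop_left_solvable:
      "\<lbrakk>x \<in> carrier Q; y \<in> carrier Q\<rbrakk> \<Longrightarrow> \<exists>!u. u \<in> carrier Q \<and> x \<otimes> u = y"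
    and loop_right_solvable:
      "\<lbrakk>x \<in> carrier Q; y \<in> carrier Q\<rbrakk> \<Longrightarrow> \<exists>!v. v \<in> carrier Q \<and> v \<otimes> x = y"

definition left_div :: "('a, 'b) monoid_scheme \<Rightarrow> 'a \<Rightarrow> 'a \<Rightarrow> 'a"
  where "left_div Q x y = (THE u. u \<in> carrier Q \<and> x \<otimes>\<^bsub>Q\<^esub> u = y)"

text \<open>The arguments of \<open>right_div\<close> are in the order of the notation \<open>y / x\<close>.\<close>

definition right_div :: "('a, 'b) monoid_scheme \<Rightarrow> 'a \<Rightarrow> 'a \<Rightarrow> 'a"
  where "right_div Q y x = (THE v. v \<in> carrier Q \<and> v \<otimes>\<^bsub>Q\<^esub> x = y)"

locale cc_loop = loop +
  assumes left_conjugacy_closed: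
    "\<exists>f \<in> carrier Q \<rightarrow> carrier Q \<rightarrow> carrier Q.
       \<forall>x \<in> carrier Q. \<forall>y \<in> carrier Q. \<forall>z \<in> carrier Q. x \<otimes> (y \<otimes> z) = f x y \<otimes> (x \<otimes> z)"
    and right_conjugacy_closed:
    "\<exists>g \<in> carrier Q \<rightarrow> carrier Q \<rightarrow> carrier Q.
       \<forall>x \<in> carrier Q. \<forall>y \<in> carrier Q. \<forall>z \<in> carrier Q. (z \<otimes> y) \<otimes> x = (z \<otimes> x) \<otimes> g x y"

text \<open>The identity of a subset that is a loop under the restricted operation is an idempotent of
  \<open>Q\<close>, hence equals \<open>\<one>\<^bsub>Q\<^esub>\<close>; so it is no restriction that the updated record keeps \<open>\<one>\<^bsub>Q\<^esub>\<close>.\<close>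

definition subloop :: "'a set \<Rightarrow> ('a, 'b) monoid_scheme \<Rightarrow> bool"
  where "subloop H Q \<longleftrightarrow> H \<subseteq> carrier Q \<and> loop (Q\<lparr>carrier := H\<rparr>)"

definition subloop_span :: "('a, 'b) monoid_scheme \<Rightarrow> 'a set \<Rightarrow> 'a set"
  where "subloop_span Q S = \<Inter>{H. subloop H Q \<and> S \<subseteq> H}"

locale extra_loop = cc_loop +
  assumes diassociative:
    "\<lbrakk>x \<in> carrier Q; y \<in> carrier Q\<rbrakk> \<Longrightarrow> group (Q\<lparr>carrier := subloop_span Q {x, y}\<rparr>)"

definition nucleus :: "('a, 'b) monoid_scheme \<Rightarrow> 'a set"
  where "nucleus Q = {a \<in> carrier Q. \<forall>x \<in> carrier Q. \<forall>y \<in> carrier Q.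
    a \<otimes>\<^bsub>Q\<^esub> (x \<otimes>\<^bsub>Q\<^esub> y) = (a \<otimes>\<^bsub>Q\<^esub> x) \<otimes>\<^bsub>Q\<^esub> y \<and>
    (x \<otimes>\<^bsub>Q\<^esub> a) \<otimes>\<^bsub>Q\<^esub> y = x \<otimes>\<^bsub>Q\<^esub> (a \<otimes>\<^bsub>Q\<^esub> y) \<and>
    x \<otimes>\<^bsub>Q\<^esub> (y \<otimes>\<^bsub>Q\<^esub> a) = (x \<otimes>\<^bsub>Q\<^esub> y) \<otimes>\<^bsub>Q\<^esub> a}"

definition nucleus_group :: "('a, 'b) monoid_scheme \<Rightarrow> ('a, 'b) monoid_scheme"
  where "nucleus_group Q = Q\<lparr>carrier := nucleus Q\<rparr>"

text \<open>\<open>l_associator\<close> is the associator \<open>(x,y,z)\<close>, formed with left division, and \<open>r_associator\<close> is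
  \<open>[x,y,z]\<close>, formed with right division.\<close>

definition l_associator :: "('a, 'b) monoid_scheme \<Rightarrow> 'a \<Rightarrow> 'a \<Rightarrow> 'a \<Rightarrow> 'a"
  where "l_associator Q x y z =
    left_div Q (x \<otimes>\<^bsub>Q\<^esub> (y \<otimes>\<^bsub>Q\<^esub> z)) ((x \<otimes>\<^bsub>Q\<^esub> y) \<otimes>\<^bsub>Q\<^esub> z)"

definition r_associator :: "('a, 'b) monoid_scheme \<Rightarrow> 'a \<Rightarrow> 'a \<Rightarrow> 'a \<Rightarrow> 'a"
  where "r_associator Q x y z =
    right_div Q (x \<otimes>\<^bsub>Q\<^esub> (y \<otimes>\<^bsub>Q\<^esub> z)) ((x \<otimes>\<^bsub>Q\<^esub> y) \<otimes>\<^bsub>Q\<^esub> z)"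

definition associators :: "('a, 'b) monoid_scheme \<Rightarrow> 'a set"
  where "associators Q =
    {l_associator Q x y z | x y z. x \<in> carrier Q \<and> y \<in> carrier Q \<and> z \<in> carrier Q}"

definition right_translation :: "('a, 'b) monoid_scheme \<Rightarrow> 'a \<Rightarrow> 'a \<Rightarrow> 'a"
  where "right_translation Q y = (\<lambda>x \<in> carrier Q. x \<otimes>\<^bsub>Q\<^esub> y)"

definition left_translation :: "('a, 'b) monoid_scheme \<Rightarrow> 'a \<Rightarrow> 'a \<Rightarrow> 'a"
  where "left_translation Q x = (\<lambda>y \<in> carrier Q. x \<otimes>\<^bsub>Q\<^esub> y)"

text \<open>Permutations act on the right and compose from left to right, whereas \<^const>\<open>BijGroup\<close> composes
  from right to left. The factors of \<open>R(x,y) = R\<^sub>x R\<^sub>y R\<^sub>x\<^sub>y\<^sup>-\<^sup>1\<close> and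
  \<open>L(x,y) = L\<^sub>x L\<^sub>y L\<^sub>y\<^sub>x\<^sup>-\<^sup>1\<close> therefore appear in reverse order.\<close>

definition right_inner :: "('a, 'b) monoid_scheme \<Rightarrow> 'a \<Rightarrow> 'a \<Rightarrow> 'a \<Rightarrow> 'a"
  where "right_inner Q x y =
    inv\<^bsub>BijGroup (carrier Q)\<^esub> (right_translation Q (x \<otimes>\<^bsub>Q\<^esub> y))
      \<otimes>\<^bsub>BijGroup (carrier Q)\<^esub> right_translation Q y
      \<otimes>\<^bsub>BijGroup (carrier Q)\<^esub> right_translation Q x"

definition left_inner :: "('a, 'b) monoid_scheme \<Rightarrow> 'a \<Rightarrow> 'a \<Rightarrow> 'a \<Rightarrow> 'a"
  where "left_inner Q x y =
    inv\<^bsub>BijGroup (carrier Q)\<^esub> (left_translation Q (y \<otimes>\<^bsub>Q\<^esub> x))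
      \<otimes>\<^bsub>BijGroup (carrier Q)\<^esub> left_translation Q y
      \<otimes>\<^bsub>BijGroup (carrier Q)\<^esub> left_translation Q x"

definition boolean_group :: "('a, 'b) monoid_scheme \<Rightarrow> bool"
  where "boolean_group G \<longleftrightarrow> group G \<and> (\<forall>u \<in> carrier G. u \<otimes>\<^bsub>G\<^esub> u = \<one>\<^bsub>G\<^esub>)"

end

theory Submission
  imports Defs
begin

text \<open>Diassociativity turns conjugacy closedness into the identity \<open>x(yz) = (xyx\<^sup>-\<^sup>1)(xz)\<close>
  and its mirror image. These give the Moufang identities and put all squares into the nucleus \<open>N\<close>,
  so \<open>Q/N\<close> is a boolean group and commutators and associators are nuclear. The map
  \<open>\<lambda>(x,y) : z \<mapsto> (xy)\<^sup>-\<^sup>1(x(yz))\<close> is an automorphism that fixes \<open>N\<close> pointwise, depends only on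
  \<open>xN\<close> and \<open>yN\<close>, is symmetric in \<open>x\<close> and \<open>y\<close>, and sends \<open>z\<close> to \<open>z(x,y,z)\<^sup>-\<^sup>1\<close>. Since
  \<open>\<lambda>(x\<^sup>-\<^sup>1,y\<^sup>-\<^sup>1)\<close> inverts \<open>\<lambda>(y,x)\<close>, it is an involution, so associators square to
  \<open>1\<close>. Applying \<open>\<lambda>(x,y)\<close> to \<open>z\<^sup>2 \<in> N\<close> shows that \<open>(x,y,z)\<close> commutes with \<open>z\<close>;
  as \<open>(x,y,xz) = (x,y,z) = (x,y,yz)\<close>, it also commutes with \<open>x\<close> and \<open>y\<close>.\<close>

section \<open>Cancellation, division and subloops in an arbitrary loop\<close>

context loop
begin

lemmas loop_simps [simp] = loop_closed loop_one_closed loop_l_one loop_r_one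

lemma left_cancel:
  assumes "x \<otimes> u = x \<otimes> v" "x \<in> carrier Q" "u \<in> carrier Q" "v \<in> carrier Q"
  shows "u = v"
  using loop_left_solvable[of x "x \<otimes> u"] assms by (metis loop_closed)

lemma right_cancel:
  assumes "u \<otimes> x = v \<otimes> x" "x \<in> carrier Q" "u \<in> carrier Q" "v \<in> carrier Q"
  shows "u = v"
  using loop_right_solvable[of x "u \<otimes> x"] assms by (metis loop_closed)

lemma left_div_eqI:
  assumes "x \<otimes> u = y" "x \<in> carrier Q" "u \<in> carrier Q"
  shows "left_div Q x y = u"
  unfolding left_div_def using assms by (intro the_equality) (auto intro: left_cancel)

lemma right_div_eqI:
  assumes "v \<otimes> x = y" "x \<in> carrier Q" "v \<in> carrier Q"
  shows "right_div Q y x = v"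
  unfolding right_div_def using assms by (intro the_equality) (auto intro: right_cancel)

lemma m_inv_eqI:
  assumes "x \<otimes> y = \<one>" "y \<otimes> x = \<one>" "x \<in> carrier Q" "y \<in> carrier Q"
  shows "inv x = y"
  unfolding m_inv_def using assms by (intro the_equality) (auto intro: left_cancel[of x])

text \<open>Supplies a member of the family intersected in \<open>subloop_span\<close>, so that
  spans of subsets of the carrier stay inside the carrier.\<close>

lemma subloop_carrier: "subloop (carrier Q) Q"
  unfolding subloop_def using loop_axioms by simp

lemma subset_subloop_span: "S \<subseteq> subloop_span Q S"
  unfolding subloop_span_def by blast

lemma subloop_span_subset_carrier: "S \<subseteq> carrier Q \<Longrightarrow> subloop_span Q S \<subseteq> carrier Q"
  unfolding subloop_span_def using subloop_carrier by blast

end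

section \<open>Consequences of diassociativity for two elements\<close>

context extra_loop
begin

text \<open>The last clause is there because \<open>m_inv\<close> refers to the carrier of its
  record, so the inverse in the subgroup is formally another constant. Both agree since inverses in
  the loop are unique.\<close>

lemma two_generated:
  assumes x: "x \<in> carrier Q" and y: "y \<in> carrier Q"
  obtains H where "group (Q\<lparr>carrier := H\<rparr>)" "x \<in> H" "y \<in> H" "H \<subseteq> carrier Q"
    "\<forall>a\<in>H. inv\<^bsub>Q\<lparr>carrier := H\<rparr>\<^esub> a = inv a"
proof -
  define H where "H = subloop_span Q {x, y}"
  interpret G: group "Q\<lparr>carrier := H\<rparr>"
    using diassociative[OF x y] unfolding H_def .
  have sub: "H \<subseteq> carrier Q"
    unfolding H_def using x y by (intro subloop_span_subset_carrier) auto
  have "{x, y} \<subseteq> H"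
    unfolding H_def by (rule subset_subloop_span)
  moreover have "inv a = inv\<^bsub>Q\<lparr>carrier := H\<rparr>\<^esub> a" if a: "a \<in> H" for a
    using G.l_inv[of a] G.r_inv[of a] G.inv_closed[of a] a sub by (intro m_inv_eqI) auto
  ultimately show ?thesis
    using sub that[of H] G.is_group by simp
qed

text \<open>Each identity involves only \<open>x\<close>, \<open>y\<close> and their inverses, so it
  can be read off in the group they generate.\<close>

lemma assoc_rules:
  assumes x: "x \<in> carrier Q" and y: "y \<in> carrier Q"
  shows "inv x \<in> carrier Q" "inv x \<otimes> x = \<one>" "x \<otimes> inv x = \<one>"
    "inv x \<otimes> (x \<otimes> y) = y" "(y \<otimes> x) \<otimes> inv x = y" "inv (x \<otimes> y) = inv y \<otimes> inv x"
    "x \<otimes> (y \<otimes> x) = (x \<otimes> y) \<otimes> x" "(x \<otimes> x) \<otimes> y = x \<otimes> (x \<otimes> y)" "(y \<otimes> x) \<otimes> x = y \<otimes> (x \<otimes> x)"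
proof -
  obtain H where H: "group (Q\<lparr>carrier := H\<rparr>)" "x \<in> H" "y \<in> H" "H \<subseteq> carrier Q"
    "\<forall>a\<in>H. inv\<^bsub>Q\<lparr>carrier := H\<rparr>\<^esub> a = inv a"
    using two_generated[OF x y] .
  interpret G: group "Q\<lparr>carrier := H\<rparr>" by fact
  have inverse: "inv a \<in> H" "inv a \<otimes> a = \<one>" "a \<otimes> inv a = \<one>" if "a \<in> H" for a
    using G.inv_closed[of a] G.l_inv[of a] G.r_inv[of a] H(5) that by auto
  have assoc: "(a \<otimes> b) \<otimes> c = a \<otimes> (b \<otimes> c)" if "a \<in> H" "b \<in> H" "c \<in> H" for a b c
    using G.m_assoc that by simp
  show "inv x \<otimes> (x \<otimes> y) = y" "(y \<otimes> x) \<otimes> inv x = y"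
    using assoc[of "inv x" x y] assoc[of y x "inv x"] inverse H(2,3) x y by auto
  show "inv (x \<otimes> y) = inv y \<otimes> inv x"
    using G.inv_mult_group[of x y] G.m_closed[of x y] H by simp
  show "inv x \<in> carrier Q" "inv x \<otimes> x = \<one>" "x \<otimes> inv x = \<one>"
    using inverse H(2,4) by auto
  show "x \<otimes> (y \<otimes> x) = (x \<otimes> y) \<otimes> x" "(x \<otimes> x) \<otimes> y = x \<otimes> (x \<otimes> y)" "(y \<otimes> x) \<otimes> x = y \<otimes> (x \<otimes> x)"
    using assoc H(2,3) by simp_all
qed

lemma inv_closed [simp]: "x \<in> carrier Q \<Longrightarrow> inv x \<in> carrier Q"
  and l_inv [simp]: "x \<in> carrier Q \<Longrightarrow> inv x \<otimes> x = \<one>"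
  and r_inv [simp]: "x \<in> carrier Q \<Longrightarrow> x \<otimes> inv x = \<one>"
  by (simp_all add: assoc_rules(1-3)[of x x])

lemmas l_inv_cancel [simp] = assoc_rules(4)
  and r_inv_cancel [simp] = assoc_rules(5)
  and inv_mult = assoc_rules(6)
  and flexible = assoc_rules(7)
  and left_alternative = assoc_rules(8)
  and right_alternative = assoc_rules(9)

lemma inv_inv [simp]: "x \<in> carrier Q \<Longrightarrow> inv (inv x) = x"
  by (rule m_inv_eqI) auto

lemma l_inv_cancel' [simp]:
  assumes "x \<in> carrier Q" "y \<in> carrier Q"
  shows "x \<otimes> (inv x \<otimes> y) = y"
  using l_inv_cancel[of "inv x" y] assms by simp

lemma r_inv_cancel' [simp]:
  assumes "x \<in> carrier Q" "y \<in> carrier Q"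
  shows "(y \<otimes> inv x) \<otimes> x = y"
  using r_inv_cancel[of "inv x" y] assms by simp

section \<open>Explicit conjugacy closedness, extra identities and Moufang identities\<close>

text \<open>Setting \<open>z = \<one>\<close> in the law for \<open>f\<close> gives
  \<open>xy = f(x,y)x\<close>, which determines \<open>f\<close>. The lemma says that conjugating a
  left translation by \<open>x\<close> yields the left translation by the conjugate.\<close>

lemma left_conj:
  assumes "x \<in> carrier Q" "y \<in> carrier Q" "z \<in> carrier Q"
  shows "x \<otimes> (y \<otimes> z) = ((x \<otimes> y) \<otimes> inv x) \<otimes> (x \<otimes> z)"
proof -
  obtain f where f: "f \<in> carrier Q \<rightarrow> carrier Q \<rightarrow> carrier Q"
    and eq: "\<forall>x \<in> carrier Q. \<forall>y \<in> carrier Q. \<forall>z \<in> carrier Q. x \<otimes> (y \<otimes> z) = f x y \<otimes> (x \<otimes> z)"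
    using left_conjugacy_closed by blast
  have c: "f x y \<in> carrier Q" using f assms by (auto simp: Pi_iff)
  have "x \<otimes> y = f x y \<otimes> x"
    using eq[rule_format, of x y \<one>] assms by simp
  then have "(x \<otimes> y) \<otimes> inv x = f x y" using c assms by simp
  then show ?thesis using eq assms by simp
qed

lemma right_conj:
  assumes "x \<in> carrier Q" "y \<in> carrier Q" "z \<in> carrier Q"
  shows "(z \<otimes> y) \<otimes> x = (z \<otimes> x) \<otimes> (inv x \<otimes> (y \<otimes> x))"
proof -
  obtain g where g: "g \<in> carrier Q \<rightarrow> carrier Q \<rightarrow> carrier Q"
    and eq: "\<forall>x \<in> carrier Q. \<forall>y \<in> carrier Q. \<forall>z \<in> carrier Q. (z \<otimes> y) \<otimes> x = (z \<otimes> x) \<otimes> g x y"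
    using right_conjugacy_closed by blast
  have c: "g x y \<in> carrier Q" using g assms by (auto simp: Pi_iff)
  have "y \<otimes> x = x \<otimes> g x y"
    using eq[rule_format, of x y \<one>] assms by simp
  then have "inv x \<otimes> (y \<otimes> x) = g x y" using c assms by simp
  then show ?thesis using eq assms by simp
qed

text \<open>The conjugate of \<open>yx\<close> by \<open>x\<close> is \<open>xy\<close>, so this is
  \<open>left_conj\<close> at \<open>yx\<close>. It and its mirror image \<open>extra_right\<close>
  are identities of Fenyves for extra loops.\<close>

lemma extra_left:
  assumes "x \<in> carrier Q" "y \<in> carrier Q" "z \<in> carrier Q"
  shows "x \<otimes> ((y \<otimes> x) \<otimes> z) = (x \<otimes> y) \<otimes> (x \<otimes> z)"
  using left_conj[of x "y \<otimes> x" z] assms by (simp add: flexible)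

lemma extra_right:
  assumes "x \<in> carrier Q" "y \<in> carrier Q" "z \<in> carrier Q"
  shows "(z \<otimes> (x \<otimes> y)) \<otimes> x = (z \<otimes> x) \<otimes> (y \<otimes> x)"
  using right_conj[of x "x \<otimes> y" z] assms by (simp flip: flexible)

lemma middle_Moufang:
  assumes "x \<in> carrier Q" "u \<in> carrier Q" "y \<in> carrier Q"
  shows "(x \<otimes> u) \<otimes> (y \<otimes> x) = (x \<otimes> (u \<otimes> y)) \<otimes> x"
proof -
  \<comment> \<open>With \<open>u = wx\<close> the left factor becomes \<open>xw\<close> times
    \<open>x\<close>, the shape to which \<open>extra_right\<close> and then
    \<open>extra_left\<close> apply.\<close>
  define w where "w = u \<otimes> inv x"
  have w: "w \<in> carrier Q" "w \<otimes> x = u" using assms by (auto simp: w_def)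
  have "(x \<otimes> (w \<otimes> x)) \<otimes> (y \<otimes> x) = ((x \<otimes> w) \<otimes> x) \<otimes> (y \<otimes> x)"
    using assms w(1) by (simp add: flexible)
  also have "\<dots> = ((x \<otimes> w) \<otimes> (x \<otimes> y)) \<otimes> x"
    using assms w(1) by (simp add: extra_right)
  also have "\<dots> = (x \<otimes> ((w \<otimes> x) \<otimes> y)) \<otimes> x"
    using assms w(1) by (simp add: extra_left)
  finally show ?thesis using w by simp
qed

text \<open>In the middle Moufang identity, the factors \<open>y(xz)\<close> and the inverse of
  \<open>xz\<close> multiply to \<open>y\<close>, while that inverse times \<open>x\<close> is
  \<open>inv z\<close>. Multiplying by \<open>z\<close> on the right then gives the claim.\<close>

lemma left_Moufang:
  assumes "x \<in> carrier Q" "y \<in> carrier Q" "z \<in> carrier Q"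
  shows "((x \<otimes> y) \<otimes> x) \<otimes> z = x \<otimes> (y \<otimes> (x \<otimes> z))"
proof -
  have "(x \<otimes> (y \<otimes> (x \<otimes> z))) \<otimes> inv z = (x \<otimes> y) \<otimes> x"
    using middle_Moufang[of x "y \<otimes> (x \<otimes> z)" "inv (x \<otimes> z)"]
      r_inv_cancel[of "x \<otimes> z" y] inv_mult[of x z] assms by simp
  then have "((x \<otimes> y) \<otimes> x) \<otimes> z = ((x \<otimes> (y \<otimes> (x \<otimes> z))) \<otimes> inv z) \<otimes> z" by simp
  then show ?thesis using assms by simp
qed

section \<open>The nucleus: one-sided criteria, closure and normality\<close>

lemma nucleusD:
  assumes "a \<in> nucleus Q"
  shows "a \<in> carrier Q"
    "\<lbrakk>x \<in> carrier Q; y \<in> carrier Q\<rbrakk> \<Longrightarrow> a \<otimes> (x \<otimes> y) = (a \<otimes> x) \<otimes> y"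
    "\<lbrakk>x \<in> carrier Q; y \<in> carrier Q\<rbrakk> \<Longrightarrow> x \<otimes> (a \<otimes> y) = (x \<otimes> a) \<otimes> y"
    "\<lbrakk>x \<in> carrier Q; y \<in> carrier Q\<rbrakk> \<Longrightarrow> x \<otimes> (y \<otimes> a) = (x \<otimes> y) \<otimes> a"
  using assms unfolding nucleus_def by auto

lemma middle_nuclear_inv:
  assumes a: "a \<in> carrier Q"
    and mid: "\<And>x y. \<lbrakk>x \<in> carrier Q; y \<in> carrier Q\<rbrakk> \<Longrightarrow> x \<otimes> (a \<otimes> y) = (x \<otimes> a) \<otimes> y"
    and xy: "x \<in> carrier Q" "y \<in> carrier Q"
  shows "x \<otimes> (inv a \<otimes> y) = (x \<otimes> inv a) \<otimes> y"
  using mid[of "x \<otimes> inv a" "inv a \<otimes> y"] a xy by simp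

text \<open>Since \<open>inv a\<close> is middle nuclear too, the inverse of \<open>ax\<close> can
  be applied to \<open>a(xy)\<close> in two stages, which leaves \<open>y\<close>.\<close>

lemma middle_nuclear_left_nuclear:
  assumes a: "a \<in> carrier Q"
    and mid: "\<And>x y. \<lbrakk>x \<in> carrier Q; y \<in> carrier Q\<rbrakk> \<Longrightarrow> x \<otimes> (a \<otimes> y) = (x \<otimes> a) \<otimes> y"
    and xy: "x \<in> carrier Q" "y \<in> carrier Q"
  shows "a \<otimes> (x \<otimes> y) = (a \<otimes> x) \<otimes> y"
proof -
  have "(inv x \<otimes> inv a) \<otimes> (a \<otimes> (x \<otimes> y)) = y"
    using middle_nuclear_inv[OF a mid, of "inv x" "a \<otimes> (x \<otimes> y)"] a xy by simp
  then have "(a \<otimes> x) \<otimes> (inv (a \<otimes> x) \<otimes> (a \<otimes> (x \<otimes> y))) = (a \<otimes> x) \<otimes> y"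
    using a xy by (simp add: inv_mult)
  then show ?thesis using a xy by simp
qed

text \<open>The left law follows from the previous lemma. The right law is the left law for
  \<open>inv a\<close> carried over by inversion, which reverses products.\<close>

lemma middle_nuclear_in_nucleus:
  assumes a: "a \<in> carrier Q"
    and mid: "\<And>x y. \<lbrakk>x \<in> carrier Q; y \<in> carrier Q\<rbrakk> \<Longrightarrow> x \<otimes> (a \<otimes> y) = (x \<otimes> a) \<otimes> y"
  shows "a \<in> nucleus Q"
proof -
  have "x \<otimes> (y \<otimes> a) = (x \<otimes> y) \<otimes> a" if "x \<in> carrier Q" "y \<in> carrier Q" for x y
  proof -
    have "inv a \<otimes> (inv y \<otimes> inv x) = (inv a \<otimes> inv y) \<otimes> inv x"
      using middle_nuclear_left_nuclear[of "inv a" "inv y" "inv x"] middle_nuclear_inv[OF a mid]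
        a that by simp
    then have "inv ((x \<otimes> y) \<otimes> a) = inv (x \<otimes> (y \<otimes> a))"
      using a that by (simp add: inv_mult)
    then show ?thesis
      using inv_inv a that by (metis loop_closed)
  qed
  then show ?thesis
    using a mid middle_nuclear_left_nuclear[OF a mid] unfolding nucleus_def by auto
qed

lemma inv_in_nucleus:
  assumes a: "a \<in> nucleus Q"
  shows "inv a \<in> nucleus Q"
  using middle_nuclear_inv[OF nucleusD(1)[OF a] nucleusD(3)[OF a]] nucleusD(1)[OF a]
  by (intro middle_nuclear_in_nucleus) auto

text \<open>The left law at \<open>inv x\<close> shows that \<open>inv a\<close> is middle nuclear.
  Hence \<open>inv a\<close>, and so \<open>a\<close>, lies in the nucleus.\<close>

lemma left_nuclear_in_nucleus:
  assumes a: "a \<in> carrier Q"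
    and left: "\<And>x y. \<lbrakk>x \<in> carrier Q; y \<in> carrier Q\<rbrakk> \<Longrightarrow> a \<otimes> (x \<otimes> y) = (a \<otimes> x) \<otimes> y"
  shows "a \<in> nucleus Q"
proof -
  have "inv a \<in> nucleus Q"
  proof (rule middle_nuclear_in_nucleus)
    fix x y assume xy: "x \<in> carrier Q" "y \<in> carrier Q"
    have "inv (a \<otimes> inv x) \<otimes> ((a \<otimes> inv x) \<otimes> (x \<otimes> (inv a \<otimes> y))) = (x \<otimes> inv a) \<otimes> y"
      using left[of "inv x" "x \<otimes> (inv a \<otimes> y)", symmetric] a xy by (simp add: inv_mult)
    then show "x \<otimes> (inv a \<otimes> y) = (x \<otimes> inv a) \<otimes> y"
      using a xy by simp
  qed (use a in simp)
  then show ?thesis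
    using inv_in_nucleus[of "inv a"] a by simp
qed

lemma mult_in_nucleus:
  assumes a: "a \<in> nucleus Q" and b: "b \<in> nucleus Q"
  shows "a \<otimes> b \<in> nucleus Q"
proof (rule left_nuclear_in_nucleus)
  fix x y assume "x \<in> carrier Q" "y \<in> carrier Q"
  then show "(a \<otimes> b) \<otimes> (x \<otimes> y) = ((a \<otimes> b) \<otimes> x) \<otimes> y"
    using nucleusD(1)[OF a] nucleusD(1)[OF b]
    by (simp flip: nucleusD(2)[OF a] nucleusD(2)[OF b])
qed (use assms nucleusD in auto)

lemma one_in_nucleus: "\<one> \<in> nucleus Q"
  by (rule left_nuclear_in_nucleus) auto

text \<open>By \<open>left_conj\<close>, conjugation by the left translation of \<open>x\<close>
  carries left translations to left translations. The left nuclear law of \<open>a\<close> is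
  transported this way, and that law alone suffices for membership.\<close>

lemma conj_in_nucleus:
  assumes a: "a \<in> nucleus Q" and x: "x \<in> carrier Q"
  shows "(x \<otimes> a) \<otimes> inv x \<in> nucleus Q"
proof (rule left_nuclear_in_nucleus)
  note ac = nucleusD(1)[OF a]
  let ?b = "(x \<otimes> a) \<otimes> inv x"
  fix u v assume uv: "u \<in> carrier Q" "v \<in> carrier Q"
  define s where "s = inv x \<otimes> (u \<otimes> x)"
  define t where "t = inv x \<otimes> v"
  have s: "s \<in> carrier Q" "(x \<otimes> s) \<otimes> inv x = u" and t: "t \<in> carrier Q" "x \<otimes> t = v"
    using x uv by (simp_all add: s_def t_def)
  \<comment> \<open>Conjugation by \<open>x\<close> need not be multiplicative in a loop, but
    \<open>right_conj\<close> makes it so on the product of \<open>a\<close> and \<open>s\<close>,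
    because \<open>a\<close> is nuclear.\<close>
  have conj: "(x \<otimes> (a \<otimes> s)) \<otimes> inv x = ?b \<otimes> u"
  proof -
    have "((?b \<otimes> u) \<otimes> x) = x \<otimes> (a \<otimes> s)"
      using right_conj[of x u ?b] nucleusD(3)[OF a, of x s] s(1) x uv ac by (simp add: s_def)
    then show ?thesis
      by (metis ac loop_closed inv_closed r_inv_cancel x uv(1))
  qed
  have "?b \<otimes> (u \<otimes> v) = ?b \<otimes> (x \<otimes> (s \<otimes> t))"
    using left_conj[of x s t] x s t by simp
  also have "\<dots> = x \<otimes> (a \<otimes> (s \<otimes> t))"
    using left_conj[of x a "s \<otimes> t"] x s(1) t(1) ac by simp
  also have "\<dots> = x \<otimes> ((a \<otimes> s) \<otimes> t)"
    using nucleusD(2)[OF a] s(1) t(1) by simp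
  also have "\<dots> = (?b \<otimes> u) \<otimes> v"
    using left_conj[of x "a \<otimes> s" t] x s(1) t ac conj by simp
  finally show "?b \<otimes> (u \<otimes> v) = (?b \<otimes> u) \<otimes> v" .
qed (use assms nucleusD in auto)

section \<open>Squares, commutators and associators are nuclear\<close>

text \<open>With \<open>w = xy\<close>, \<open>extra_left\<close> pulls the first \<open>x\<close>
  to the front, and \<open>left_Moufang\<close> regroups the rest so that both copies of
  \<open>x\<close> join \<open>w\<close>.\<close>

lemma square_in_nucleus:
  assumes x: "x \<in> carrier Q"
  shows "x \<otimes> x \<in> nucleus Q"
proof (rule middle_nuclear_in_nucleus)
  fix w z assume wz: "w \<in> carrier Q" "z \<in> carrier Q"
  define y where "y = inv x \<otimes> w"
  have y: "y \<in> carrier Q" "x \<otimes> y = w" using x wz by (auto simp: y_def)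
  have "w \<otimes> ((x \<otimes> x) \<otimes> z) = (x \<otimes> y) \<otimes> (x \<otimes> (x \<otimes> z))"
    using x wz y by (simp add: left_alternative)
  also have "\<dots> = x \<otimes> ((y \<otimes> x) \<otimes> (x \<otimes> z))"
    using x wz(2) y(1) by (simp add: extra_left)
  also have "\<dots> = ((x \<otimes> (y \<otimes> x)) \<otimes> x) \<otimes> z"
    using x wz(2) y(1) by (simp add: left_Moufang)
  also have "\<dots> = (w \<otimes> (x \<otimes> x)) \<otimes> z"
    using x y wz by (simp add: flexible right_alternative)
  finally show "w \<otimes> ((x \<otimes> x) \<otimes> z) = (w \<otimes> (x \<otimes> x)) \<otimes> z" .
qed (use x in simp)

lemma nucleus_swap:
  assumes "n \<in> nucleus Q" "x \<in> carrier Q"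
  obtains m where "m \<in> nucleus Q" "x \<otimes> n = m \<otimes> x"
  using that[OF conj_in_nucleus[OF assms]] assms nucleusD by simp

lemma commutator_nuclear:
  assumes "x \<in> carrier Q" "y \<in> carrier Q"
  obtains n where "n \<in> nucleus Q" "x \<otimes> y = n \<otimes> (y \<otimes> x)" "(x \<otimes> y) \<otimes> inv x = n \<otimes> y"
proof -
  \<comment> \<open>The commutator written with squares:
    \<open>x y x^-1 y^-1 = (xy)^2 (y^-1 x^-2 y) y^-2\<close>. Each factor is a square or a conjugate
    of one, and the equality is checked in the group generated by \<open>x\<close> and
    \<open>y\<close>.\<close>
  define n where "n = (x \<otimes> y) \<otimes> (x \<otimes> y) \<otimes>
    (((inv y \<otimes> (inv x \<otimes> inv x)) \<otimes> inv (inv y)) \<otimes> (inv y \<otimes> inv y))"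
  have n: "n \<in> nucleus Q"
    unfolding n_def using assms
    by (intro mult_in_nucleus square_in_nucleus conj_in_nucleus) auto
  obtain H where H: "group (Q\<lparr>carrier := H\<rparr>)" "x \<in> H" "y \<in> H" "H \<subseteq> carrier Q"
    "\<forall>a\<in>H. inv\<^bsub>Q\<lparr>carrier := H\<rparr>\<^esub> a = inv a"
    using two_generated[OF assms] .
  interpret G: group "Q\<lparr>carrier := H\<rparr>" by fact
  have closed: "a \<otimes> b \<in> H" if "a \<in> H" "b \<in> H" for a b
    using G.m_closed that by simp
  have inv_H: "inv a \<in> H" if "a \<in> H" for a
    using G.inv_closed[of a] H(5) that by simp
  have assoc: "(a \<otimes> b) \<otimes> c = a \<otimes> (b \<otimes> c)" if "a \<in> H" "b \<in> H" "c \<in> H" for a b c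
    using G.m_assoc that by simp
  have carrier: "a \<in> carrier Q" if "a \<in> H" for a
    using H(4) that by auto
  have eq: "n = ((x \<otimes> y) \<otimes> inv x) \<otimes> inv y"
    unfolding n_def using H(2,3) by (simp add: assoc closed inv_H carrier)
  have "n \<otimes> y = (x \<otimes> y) \<otimes> inv x"
    using assms eq by simp
  moreover from this have "n \<otimes> (y \<otimes> x) = x \<otimes> y"
    using nucleusD(2)[OF n] assms by simp
  ultimately show ?thesis using n that by simp
qed

text \<open>The conjugate of \<open>y\<close> by \<open>x\<close> is \<open>ny\<close>, so
  \<open>left_conj\<close> yields the second equation with the same \<open>n\<close>. This shared
  factor is what later cancels in \<open>left_assoc_map_commute\<close>.\<close>

lemma left_commutative_mod_nucleus:
  assumes "x \<in> carrier Q" "y \<in> carrier Q" "z \<in> carrier Q"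
  obtains n where "n \<in> nucleus Q" "x \<otimes> y = n \<otimes> (y \<otimes> x)"
    "x \<otimes> (y \<otimes> z) = n \<otimes> (y \<otimes> (x \<otimes> z))"
proof -
  obtain n where n: "n \<in> nucleus Q" "x \<otimes> y = n \<otimes> (y \<otimes> x)" "(x \<otimes> y) \<otimes> inv x = n \<otimes> y"
    using commutator_nuclear assms(1,2) by metis
  have "x \<otimes> (y \<otimes> z) = n \<otimes> (y \<otimes> (x \<otimes> z))"
    using left_conj[OF assms] n(3) nucleusD(2)[OF n(1)] assms by simp
  with n(1,2) show ?thesis using that by blast
qed

text \<open>Modulo the nucleus, \<open>(xy)z\<close>, \<open>z(xy)\<close>, \<open>x(zy)\<close> and
  \<open>x(yz)\<close> agree in turn. The nuclear factor \<open>c\<close> arises to the right of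
  \<open>x\<close> and is moved to the left by normality.\<close>

lemma associative_mod_nucleus:
  assumes x: "x \<in> carrier Q" and y: "y \<in> carrier Q" and z: "z \<in> carrier Q"
  obtains n where "n \<in> nucleus Q" "(x \<otimes> y) \<otimes> z = n \<otimes> (x \<otimes> (y \<otimes> z))"
proof -
  obtain a where a: "a \<in> nucleus Q" "(x \<otimes> y) \<otimes> z = a \<otimes> (z \<otimes> (x \<otimes> y))"
    using commutator_nuclear[of "x \<otimes> y" z] x y z by auto
  obtain b where b: "b \<in> nucleus Q" "z \<otimes> (x \<otimes> y) = b \<otimes> (x \<otimes> (z \<otimes> y))"
    using left_commutative_mod_nucleus[of z x y] x y z by auto
  obtain c where c: "c \<in> nucleus Q" "z \<otimes> y = c \<otimes> (y \<otimes> z)"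
    using commutator_nuclear[of z y] y z by auto
  obtain d where d: "d \<in> nucleus Q" "x \<otimes> c = d \<otimes> x"
    using nucleus_swap[OF c(1) x] by auto
  have "x \<otimes> (z \<otimes> y) = d \<otimes> (x \<otimes> (y \<otimes> z))"
    using nucleusD(3)[OF c(1)] nucleusD(2)[OF d(1)] c(2) d(2) x y z by simp
  then have "(x \<otimes> y) \<otimes> z = a \<otimes> (b \<otimes> (d \<otimes> (x \<otimes> (y \<otimes> z))))"
    using a(2) b(2) by simp
  also have "\<dots> = (a \<otimes> (b \<otimes> d)) \<otimes> (x \<otimes> (y \<otimes> z))"
    using nucleusD(1)[OF a(1)] nucleusD(1)[OF b(1)] nucleusD(1)[OF d(1)] x y z
    by (simp add: nucleusD(2)[OF a(1)] nucleusD(2)[OF b(1)])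
  finally show ?thesis
    using that a(1) b(1) d(1) mult_in_nucleus by blast
qed

lemma l_associator_eq:
  assumes "x \<in> carrier Q" "y \<in> carrier Q" "z \<in> carrier Q"
  shows "l_associator Q x y z = inv (x \<otimes> (y \<otimes> z)) \<otimes> ((x \<otimes> y) \<otimes> z)"
  unfolding l_associator_def using assms by (intro left_div_eqI) auto

lemma l_associator_mult:
  assumes "x \<in> carrier Q" "y \<in> carrier Q" "z \<in> carrier Q"
  shows "(x \<otimes> (y \<otimes> z)) \<otimes> l_associator Q x y z = (x \<otimes> y) \<otimes> z"
  using assms by (simp add: l_associator_eq)

text \<open>The factor \<open>n\<close> stands on the left of \<open>x(yz)\<close>, the associator
  on its right, so the associator is a conjugate of \<open>n\<close>.\<close>

lemma l_associator_in_nucleus: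
  assumes "x \<in> carrier Q" "y \<in> carrier Q" "z \<in> carrier Q"
  shows "l_associator Q x y z \<in> nucleus Q"
proof -
  let ?w = "x \<otimes> (y \<otimes> z)"
  have w: "?w \<in> carrier Q" using assms by simp
  obtain n where n: "n \<in> nucleus Q" "(x \<otimes> y) \<otimes> z = n \<otimes> ?w"
    using associative_mod_nucleus assms by metis
  have "l_associator Q x y z = (inv ?w \<otimes> n) \<otimes> inv (inv ?w)"
    using n nucleusD(3)[OF n(1), of "inv ?w" ?w] assms by (simp add: l_associator_eq)
  then show ?thesis
    using conj_in_nucleus[OF n(1), of "inv ?w"] w by simp
qed

section \<open>The automorphism measuring failure of left associativity\<close>

text \<open>This is \<open>L(y,x)\<close> in the right-acting notation of the statement.\<close>

definition left_assoc_map :: "'a \<Rightarrow> 'a \<Rightarrow> 'a \<Rightarrow> 'a"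
  where "left_assoc_map x y z = inv (x \<otimes> y) \<otimes> (x \<otimes> (y \<otimes> z))"

lemma left_assoc_map_closed [simp]:
  "\<lbrakk>x \<in> carrier Q; y \<in> carrier Q; z \<in> carrier Q\<rbrakk> \<Longrightarrow> left_assoc_map x y z \<in> carrier Q"
  by (simp add: left_assoc_map_def)

lemma mult_left_assoc_map:
  "\<lbrakk>x \<in> carrier Q; y \<in> carrier Q; z \<in> carrier Q\<rbrakk> \<Longrightarrow>
    (x \<otimes> y) \<otimes> left_assoc_map x y z = x \<otimes> (y \<otimes> z)"
  by (simp add: left_assoc_map_def)

lemma left_assoc_map_eqI:
  assumes "(x \<otimes> y) \<otimes> w = x \<otimes> (y \<otimes> z)"
    "x \<in> carrier Q" "y \<in> carrier Q" "z \<in> carrier Q" "w \<in> carrier Q"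
  shows "left_assoc_map x y z = w"
  using assms by (simp add: left_assoc_map_def flip: assms(1))

lemma left_assoc_map_nucleus:
  assumes "n \<in> nucleus Q" "x \<in> carrier Q" "y \<in> carrier Q"
  shows "left_assoc_map x y n = n"
  using nucleusD[OF assms(1)] assms by (intro left_assoc_map_eqI) auto

text \<open>Conjugating \<open>L\<^sub>u\<close> by the automorphism candidate gives again a left translation, because
  conjugating by any left translation does.\<close>

lemma left_assoc_map_mult:
  assumes x: "x \<in> carrier Q" and y: "y \<in> carrier Q" and u: "u \<in> carrier Q" and v: "v \<in> carrier Q"
  shows "left_assoc_map x y (u \<otimes> v) = left_assoc_map x y u \<otimes> left_assoc_map x y v"
proof -
  define c where "c = x \<otimes> y"
  \<comment> \<open>\<open>g\<close> is \<open>u\<close> conjugated by \<open>y\<close> and then by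
    \<open>x\<close>; \<open>h\<close> is \<open>g\<close> conjugated back by \<open>xy\<close>.
    Thus left multiplication by \<open>u\<close> becomes left multiplication by
    \<open>h\<close>.\<close>
  define g where "g = (x \<otimes> ((y \<otimes> u) \<otimes> inv y)) \<otimes> inv x"
  define h where "h = inv c \<otimes> (g \<otimes> c)"
  have cl: "c \<in> carrier Q" "g \<in> carrier Q" "h \<in> carrier Q"
    using x y u by (auto simp: c_def g_def h_def)
  have conj: "(c \<otimes> h) \<otimes> inv c = g" using cl by (simp add: h_def)
  have transl: "left_assoc_map x y (u \<otimes> w) = h \<otimes> left_assoc_map x y w" if w: "w \<in> carrier Q" for w
  proof (rule left_assoc_map_eqI)
    have "x \<otimes> (y \<otimes> (u \<otimes> w)) = g \<otimes> (x \<otimes> (y \<otimes> w))"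
      using left_conj[of y u w] left_conj[of x "(y \<otimes> u) \<otimes> inv y" "y \<otimes> w"] x y u w
      by (simp add: g_def)
    also have "\<dots> = g \<otimes> (c \<otimes> left_assoc_map x y w)"
      using x y w by (simp add: c_def mult_left_assoc_map)
    also have "\<dots> = c \<otimes> (h \<otimes> left_assoc_map x y w)"
      using left_conj[of c h "left_assoc_map x y w"] conj cl x y w by simp
    finally show "(x \<otimes> y) \<otimes> (h \<otimes> left_assoc_map x y w) = x \<otimes> (y \<otimes> (u \<otimes> w))"
      by (simp add: c_def)
  qed (use x y u w cl in auto)
  \<comment> \<open>Evaluating at \<open>\<one>\<close>, which the map fixes, identifies
    \<open>h\<close> as the image of \<open>u\<close>.\<close>
  have "left_assoc_map x y u = h"
    using transl[of \<one>] left_assoc_map_nucleus[OF one_in_nucleus x y] u cl by simp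
  then show ?thesis using transl[OF v] by simp
qed

lemma left_assoc_map_inv:
  assumes "x \<in> carrier Q" "y \<in> carrier Q" "z \<in> carrier Q"
  shows "left_assoc_map x y (inv z) = inv (left_assoc_map x y z)"
proof -
  have "left_assoc_map x y z \<otimes> left_assoc_map x y (inv z) = \<one>"
    "left_assoc_map x y (inv z) \<otimes> left_assoc_map x y z = \<one>"
    using left_assoc_map_mult[of x y z "inv z"] left_assoc_map_mult[of x y "inv z" z]
      left_assoc_map_nucleus[OF one_in_nucleus, of x y] assms by auto
  then show ?thesis using m_inv_eqI assms by simp
qed

lemma left_assoc_map_nucleus_left:
  assumes n: "n \<in> nucleus Q" and "x \<in> carrier Q" "y \<in> carrier Q" "z \<in> carrier Q"
  shows "left_assoc_map (n \<otimes> x) y z = left_assoc_map x y z"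
proof (rule left_assoc_map_eqI)
  show "((n \<otimes> x) \<otimes> y) \<otimes> left_assoc_map x y z = (n \<otimes> x) \<otimes> (y \<otimes> z)"
    using assms(2-4) nucleusD(1)[OF n]
    by (simp add: mult_left_assoc_map flip: nucleusD(2)[OF n])
qed (use assms nucleusD(1) in auto)

text \<open>Normality rewrites \<open>xn\<close> as \<open>mx\<close>, which reduces this to a
  nuclear factor on the first argument.\<close>

lemma left_assoc_map_nucleus_right:
  assumes n: "n \<in> nucleus Q" and xyz: "x \<in> carrier Q" "y \<in> carrier Q" "z \<in> carrier Q"
  shows "left_assoc_map x (n \<otimes> y) z = left_assoc_map x y z"
proof -
  obtain m where m: "m \<in> nucleus Q" "x \<otimes> n = m \<otimes> x"
    using nucleus_swap n xyz by metis
  have "left_assoc_map x (n \<otimes> y) z = left_assoc_map (x \<otimes> n) y z"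
    using xyz nucleusD(1)[OF n]
    by (simp add: left_assoc_map_def nucleusD(3)[OF n] flip: nucleusD(2)[OF n])
  then show ?thesis
    using m xyz by (simp add: left_assoc_map_nucleus_left)
qed

text \<open>Squares are nuclear and \<open>x^-1 = x^-2 x\<close>, so inverting an argument only
  changes it by a nuclear factor.\<close>

lemma left_assoc_map_inverses:
  assumes "x \<in> carrier Q" "y \<in> carrier Q" "z \<in> carrier Q"
  shows "left_assoc_map (inv x) (inv y) z = left_assoc_map x y z"
proof -
  have inverse: "\<exists>n\<in>nucleus Q. inv a = n \<otimes> a" if "a \<in> carrier Q" for a
    using that by (intro bexI[of _ "inv a \<otimes> inv a"]) (auto intro: square_in_nucleus)
  obtain n m where "n \<in> nucleus Q" "inv x = n \<otimes> x" "m \<in> nucleus Q" "inv y = m \<otimes> y"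
    using inverse assms by metis
  then show ?thesis
    using assms nucleusD(1)
    by (simp add: left_assoc_map_nucleus_left left_assoc_map_nucleus_right)
qed

lemma left_assoc_map_commute:
  assumes "x \<in> carrier Q" "y \<in> carrier Q" "z \<in> carrier Q"
  shows "left_assoc_map x y z = left_assoc_map y x z"
proof (rule left_assoc_map_eqI)
  obtain n where n: "n \<in> nucleus Q" "x \<otimes> y = n \<otimes> (y \<otimes> x)"
    "x \<otimes> (y \<otimes> z) = n \<otimes> (y \<otimes> (x \<otimes> z))"
    using left_commutative_mod_nucleus assms by metis
  show "(x \<otimes> y) \<otimes> left_assoc_map y x z = x \<otimes> (y \<otimes> z)"
    using assms by (simp add: n(2,3) mult_left_assoc_map flip: nucleusD(2)[OF n(1)])
qed (use assms in auto)

lemma left_assoc_map_fixes: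
  assumes "x \<in> carrier Q" "y \<in> carrier Q"
  shows "left_assoc_map x y x = x" "left_assoc_map x y y = y"
  using assms by (auto intro!: left_assoc_map_eqI simp: flexible right_alternative)

text \<open>The map at \<open>x, y\<close> fixes both arguments, so the factor \<open>yx\<close>
  passes through it. Computed instead at \<open>inv x, inv y\<close>, it cancels the multiplications
  in \<open>y(xz)\<close> and returns \<open>(yx)z\<close>.\<close>

lemma left_assoc_map_involution:
  assumes "x \<in> carrier Q" "y \<in> carrier Q" "z \<in> carrier Q"
  shows "left_assoc_map x y (left_assoc_map x y z) = z"
proof -
  have "(y \<otimes> x) \<otimes> left_assoc_map x y (left_assoc_map y x z)
      = left_assoc_map x y ((y \<otimes> x) \<otimes> left_assoc_map y x z)"
    using assms by (simp add: left_assoc_map_mult left_assoc_map_fixes)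
  also have "\<dots> = left_assoc_map (inv x) (inv y) (y \<otimes> (x \<otimes> z))"
    using assms by (simp add: left_assoc_map_inverses mult_left_assoc_map)
  also have "\<dots> = (y \<otimes> x) \<otimes> z"
    using assms by (simp add: left_assoc_map_def inv_mult)
  finally have "left_assoc_map x y (left_assoc_map y x z) = z"
    using assms left_cancel by (meson left_assoc_map_closed loop_closed)
  then show ?thesis
    using assms left_assoc_map_commute by simp
qed

text \<open>An automorphism commutes with inversion, and inversion interchanges left and right
  translations.\<close>

lemma right_assoc_map_eq:
  assumes "x \<in> carrier Q" "y \<in> carrier Q" "z \<in> carrier Q"
  shows "((z \<otimes> x) \<otimes> y) \<otimes> inv (x \<otimes> y) = left_assoc_map x y z"
proof -
  have "inv (((z \<otimes> x) \<otimes> y) \<otimes> inv (x \<otimes> y)) = left_assoc_map (inv y) (inv x) (inv z)"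
    using assms by (simp add: left_assoc_map_def inv_mult)
  also have "\<dots> = inv (left_assoc_map x y z)"
    using assms left_assoc_map_commute[of x y z] by (simp add: left_assoc_map_inverses left_assoc_map_inv)
  finally have "inv (inv (((z \<otimes> x) \<otimes> y) \<otimes> inv (x \<otimes> y))) = inv (inv (left_assoc_map x y z))"
    by simp
  then show ?thesis
    using assms inv_inv loop_closed inv_closed left_assoc_map_closed by metis
qed

section \<open>Order and commutation properties of associators\<close>

lemma left_assoc_map_eq_mult_inv_associator:
  assumes "x \<in> carrier Q" "y \<in> carrier Q" "z \<in> carrier Q"
  shows "left_assoc_map x y z \<otimes> l_associator Q x y z = z"
proof (rule left_cancel)
  note a = l_associator_in_nucleus[OF assms]
  show "(x \<otimes> y) \<otimes> (left_assoc_map x y z \<otimes> l_associator Q x y z) = (x \<otimes> y) \<otimes> z"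
    using assms by (simp add: nucleusD(4)[OF a] mult_left_assoc_map l_associator_mult)
qed (use assms l_associator_in_nucleus nucleusD(1) in auto)

text \<open>Write \<open>f\<close> for the map and \<open>a\<close> for the associator. Applying the
  involution \<open>f\<close> to \<open>z = f(z)a\<close>, with \<open>a\<close> fixed, gives
  \<open>f(z) = za\<close>, so \<open>z = (za)a\<close>.\<close>

lemma associator_square:
  assumes "x \<in> carrier Q" "y \<in> carrier Q" "z \<in> carrier Q"
  shows "l_associator Q x y z \<otimes> l_associator Q x y z = \<one>"
proof -
  let ?a = "l_associator Q x y z" and ?f = "left_assoc_map x y"
  note a = l_associator_in_nucleus[OF assms] and eq = left_assoc_map_eq_mult_inv_associator[OF assms]
  note ac = nucleusD(1)[OF a]
  have "?f z = ?f (?f z \<otimes> ?a)" using eq by simp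
  also have "\<dots> = z \<otimes> ?a"
    using assms ac by (simp add: left_assoc_map_mult left_assoc_map_involution left_assoc_map_nucleus[OF a])
  finally have "z \<otimes> (?a \<otimes> ?a) = z \<otimes> \<one>"
    using eq ac assms by (simp add: nucleusD(4)[OF a])
  then show ?thesis
    using left_cancel ac assms by (meson loop_closed loop_one_closed)
qed

lemma left_assoc_map_eq_mult_associator:
  assumes "x \<in> carrier Q" "y \<in> carrier Q" "z \<in> carrier Q"
  shows "left_assoc_map x y z = z \<otimes> l_associator Q x y z"
proof -
  let ?a = "l_associator Q x y z"
  note a = l_associator_in_nucleus[OF assms]
  have "(left_assoc_map x y z \<otimes> ?a) \<otimes> ?a = left_assoc_map x y z"
    using assms nucleusD(1)[OF a] associator_square[OF assms] right_alternative by simp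
  then show ?thesis
    using left_assoc_map_eq_mult_inv_associator[OF assms] by simp
qed

text \<open>The square of \<open>z\<close> is nuclear, hence fixed by the map, while
  \<open>z\<close> goes to \<open>za\<close>. So \<open>(za)(za) = zz\<close>, that is
  \<open>aza = z\<close>, and \<open>a\<close> is its own inverse.\<close>

lemma associator_commutes_third:
  assumes "x \<in> carrier Q" "y \<in> carrier Q" "z \<in> carrier Q"
  shows "l_associator Q x y z \<otimes> z = z \<otimes> l_associator Q x y z"
proof -
  let ?a = "l_associator Q x y z" and ?f = "left_assoc_map x y"
  note a = l_associator_in_nucleus[OF assms]
  note ac = nucleusD(1)[OF a]
  have "(z \<otimes> ?a) \<otimes> (z \<otimes> ?a) = ?f (z \<otimes> z)"
    unfolding left_assoc_map_eq_mult_associator[OF assms, symmetric]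
    using assms by (simp add: left_assoc_map_mult)
  also have "\<dots> = z \<otimes> z"
    using assms square_in_nucleus left_assoc_map_nucleus by simp
  finally have "z \<otimes> (?a \<otimes> (z \<otimes> ?a)) = z \<otimes> z"
    using assms ac by (simp add: nucleusD(3)[OF a])
  then have "?a \<otimes> (z \<otimes> ?a) = z"
    using left_cancel assms ac by (meson loop_closed)
  then have "?a \<otimes> z = ?a \<otimes> (?a \<otimes> (z \<otimes> ?a))" by simp
  also have "\<dots> = z \<otimes> ?a"
    using left_alternative[of ?a "z \<otimes> ?a"] associator_square[OF assms] assms ac by simp
  finally show ?thesis .
qed

text \<open>If \<open>w\<close> is fixed, the associators of \<open>x, y, wz\<close> and of
  \<open>x, y, z\<close> coincide. This element commutes with its third arguments \<open>wz\<close>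
  and \<open>z\<close>, hence with \<open>w\<close>. It is applied to \<open>w = x\<close> and
  \<open>w = y\<close>.\<close>

lemma associator_commutes_fixed:
  assumes xyz: "x \<in> carrier Q" "y \<in> carrier Q" "z \<in> carrier Q"
    and w: "w \<in> carrier Q" and fixed: "left_assoc_map x y w = w"
  shows "l_associator Q x y z \<otimes> w = w \<otimes> l_associator Q x y z"
proof -
  let ?a = "l_associator Q x y z" and ?b = "l_associator Q x y (w \<otimes> z)"
  note a = l_associator_in_nucleus[OF xyz]
  note ac = nucleusD(1)[OF a]
  have b: "?b \<in> carrier Q" using l_associator_in_nucleus nucleusD(1) xyz w by simp
  have "(w \<otimes> z) \<otimes> ?b = w \<otimes> (z \<otimes> ?a)"
    using left_assoc_map_mult[of x y w z] fixed xyz w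
    by (simp add: left_assoc_map_eq_mult_associator[of x y z]
        left_assoc_map_eq_mult_associator[of x y "w \<otimes> z"])
  also have "\<dots> = (w \<otimes> z) \<otimes> ?a" using w xyz by (simp add: nucleusD(4)[OF a])
  finally have "?b = ?a" using left_cancel b ac w xyz by (meson loop_closed)
  then have "?a \<otimes> (w \<otimes> z) = (w \<otimes> z) \<otimes> ?a"
    using associator_commutes_third[of x y "w \<otimes> z"] w xyz by simp
  also have "\<dots> = w \<otimes> (?a \<otimes> z)"
    using associator_commutes_third[OF xyz] w xyz by (simp flip: nucleusD(4)[OF a])
  finally have "(?a \<otimes> w) \<otimes> z = (w \<otimes> ?a) \<otimes> z"
    using w xyz by (simp add: nucleusD(2,3)[OF a])
  then show ?thesis
    using right_cancel ac w xyz by (meson loop_closed)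
qed

lemma associator_commutes:
  assumes "x \<in> carrier Q" "y \<in> carrier Q" "z \<in> carrier Q"
  shows "l_associator Q x y z \<otimes> x = x \<otimes> l_associator Q x y z"
    "l_associator Q x y z \<otimes> y = y \<otimes> l_associator Q x y z"
    "l_associator Q x y z \<otimes> z = z \<otimes> l_associator Q x y z"
  using assms associator_commutes_fixed left_assoc_map_fixes associator_commutes_third by blast+

text \<open>The associator moves through \<open>(xy)z\<close> from left to right, commuting with one
  factor at a time; there \<open>(xy)z = (x(yz))a\<close> and \<open>aa = \<one>\<close> finish the
  computation.\<close>

lemma r_associator_eq:
  assumes "x \<in> carrier Q" "y \<in> carrier Q" "z \<in> carrier Q"
  shows "r_associator Q x y z = l_associator Q x y z"
  unfolding r_associator_def
proof (rule right_div_eqI)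
  let ?a = "l_associator Q x y z"
  note a = l_associator_in_nucleus[OF assms]
  have "?a \<otimes> ((x \<otimes> y) \<otimes> z) = ((?a \<otimes> x) \<otimes> y) \<otimes> z"
    using assms by (simp add: nucleusD(2)[OF a])
  also have "\<dots> = (x \<otimes> (?a \<otimes> y)) \<otimes> z"
    using assms by (simp add: associator_commutes(1) nucleusD(3)[OF a])
  also have "\<dots> = (x \<otimes> y) \<otimes> (?a \<otimes> z)"
    using assms by (simp add: associator_commutes(2) nucleusD(3,4)[OF a])
  also have "\<dots> = ((x \<otimes> y) \<otimes> z) \<otimes> ?a"
    using assms by (simp add: associator_commutes(3) nucleusD(4)[OF a])
  also have "\<dots> = ((x \<otimes> (y \<otimes> z)) \<otimes> ?a) \<otimes> ?a"
    using assms by (simp add: l_associator_mult)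
  also have "\<dots> = x \<otimes> (y \<otimes> z)"
    using assms nucleusD(1)[OF a] right_alternative associator_square by simp
  finally show "?a \<otimes> ((x \<otimes> y) \<otimes> z) = x \<otimes> (y \<otimes> z)" .
qed (use assms l_associator_in_nucleus nucleusD(1) in auto)

text \<open>With \<open>zn = mz\<close>, the automorphism sends the two sides to
  \<open>(za)n\<close> and \<open>m(za)\<close>, and the latter is \<open>z(na)\<close>.\<close>

lemma associator_commutes_nucleus:
  assumes xyz: "x \<in> carrier Q" "y \<in> carrier Q" "z \<in> carrier Q" and n: "n \<in> nucleus Q"
  shows "l_associator Q x y z \<otimes> n = n \<otimes> l_associator Q x y z"
proof -
  let ?a = "l_associator Q x y z" and ?f = "left_assoc_map x y"
  note a = l_associator_in_nucleus[OF xyz]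
  note ac = nucleusD(1)[OF a] and nc = nucleusD(1)[OF n]
  obtain m where m: "m \<in> nucleus Q" "z \<otimes> n = m \<otimes> z"
    using nucleus_swap n xyz by metis
  note mc = nucleusD(1)[OF m(1)]
  have "z \<otimes> (?a \<otimes> n) = ?f z \<otimes> n"
    using xyz ac nc by (simp add: left_assoc_map_eq_mult_associator nucleusD(4)[OF n])
  also have "\<dots> = ?f (z \<otimes> n)"
    using xyz nc by (simp add: left_assoc_map_mult left_assoc_map_nucleus[OF n])
  also have "\<dots> = m \<otimes> ?f z"
    using xyz mc by (simp add: m(2) left_assoc_map_mult left_assoc_map_nucleus[OF m(1)])
  also have "\<dots> = (m \<otimes> z) \<otimes> ?a"
    using xyz ac by (simp add: left_assoc_map_eq_mult_associator nucleusD(2)[OF m(1)])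
  also have "\<dots> = z \<otimes> (n \<otimes> ?a)"
    using xyz ac by (simp add: nucleusD(3)[OF n] flip: m(2))
  finally show ?thesis
    using left_cancel xyz ac nc by (meson loop_closed)
qed

section \<open>The boolean group generated by the associators\<close>

lemma group_nucleus_group: "group (nucleus_group Q)"
proof (rule groupI)
  fix x assume "x \<in> carrier (nucleus_group Q)"
  then have "x \<in> nucleus Q" by (simp add: nucleus_group_def)
  then show "\<exists>y\<in>carrier (nucleus_group Q). y \<otimes>\<^bsub>nucleus_group Q\<^esub> x = \<one>\<^bsub>nucleus_group Q\<^esub>"
    by (intro bexI[of _ "inv x"]) (auto simp: nucleus_group_def inv_in_nucleus nucleusD)
qed (auto simp: nucleus_group_def mult_in_nucleus one_in_nucleus nucleusD)

lemma associators_subset_nucleus: "associators Q \<subseteq> nucleus Q"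
  unfolding associators_def using l_associator_in_nucleus by auto

lemma boolean_group_associators:
  "boolean_group (subgroup_generated (nucleus_group Q) (associators Q))"
proof -
  interpret N: group "nucleus_group Q" by (rule group_nucleus_group)
  have mult: "x \<otimes>\<^bsub>nucleus_group Q\<^esub> y = x \<otimes> y"
    and unit: "\<one>\<^bsub>nucleus_group Q\<^esub> = \<one>" and carrier: "carrier (nucleus_group Q) = nucleus Q" for x y
    by (auto simp: nucleus_group_def)
  have associator: "u \<in> nucleus Q \<and> u \<otimes> u = \<one> \<and> (\<forall>n\<in>nucleus Q. u \<otimes> n = n \<otimes> u)"
    if u: "u \<in> associators Q" for u
  proof -
    obtain x y z where "u = l_associator Q x y z" "x \<in> carrier Q" "y \<in> carrier Q" "z \<in> carrier Q"
      using u unfolding associators_def by blast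
    then show ?thesis
      using l_associator_in_nucleus associator_square associator_commutes_nucleus by metis
  qed
  \<comment> \<open>Centrality in the nucleus strengthens the induction: a product of involutions
    needs commuting factors to be an involution. The intersection with the nucleus is how
    \<open>subgroup_generated\<close> restricts its generators.\<close>
  have central: "u \<in> nucleus Q \<and> u \<otimes> u = \<one> \<and> (\<forall>n\<in>nucleus Q. u \<otimes> n = n \<otimes> u)"
    if "u \<in> generate (nucleus_group Q) (nucleus Q \<inter> associators Q)" for u
    using that
  proof (induction rule: generate.induct)
    case one
    then show ?case using one_in_nucleus nucleusD(1) by (auto simp: unit)
  next
    case (incl h)
    then show ?case using associator by blast
  next
    case (inv h)
    then have h: "h \<in> nucleus Q" "h \<otimes> h = \<one>" "\<forall>n\<in>nucleus Q. h \<otimes> n = n \<otimes> h"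
      using associator by blast+
    have "inv\<^bsub>nucleus_group Q\<^esub> h = h"
      using h(1,2) by (intro N.inv_equality) (auto simp: carrier mult unit)
    then show ?case using h by metis
  next
    case (eng g h)
    then have g: "g \<in> nucleus Q" "g \<otimes> g = \<one>" and h: "h \<in> nucleus Q" "h \<otimes> h = \<one>"
      and cg: "\<And>n. n \<in> nucleus Q \<Longrightarrow> g \<otimes> n = n \<otimes> g"
      and ch: "\<And>n. n \<in> nucleus Q \<Longrightarrow> h \<otimes> n = n \<otimes> h"
      by blast+
    note gc = nucleusD(1)[OF g(1)] and hc = nucleusD(1)[OF h(1)]
    have "(g \<otimes> h) \<otimes> (g \<otimes> h) = (g \<otimes> (h \<otimes> g)) \<otimes> h"
      using gc hc by (simp add: nucleusD(2)[OF g(1)] nucleusD(4)[OF h(1)])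
    also have "\<dots> = (g \<otimes> (g \<otimes> h)) \<otimes> h" by (simp only: ch[OF g(1)])
    also have "\<dots> = (g \<otimes> g) \<otimes> (h \<otimes> h)"
      using gc hc by (simp add: nucleusD(2)[OF g(1)] nucleusD(4)[OF h(1)])
    finally have "(g \<otimes> h) \<otimes> (g \<otimes> h) = \<one>" using gc hc by (simp add: g(2) h(2))
    moreover have "(g \<otimes> h) \<otimes> n = n \<otimes> (g \<otimes> h)" if n: "n \<in> nucleus Q" for n
    proof -
      note nc = nucleusD(1)[OF n]
      have "(g \<otimes> h) \<otimes> n = g \<otimes> (h \<otimes> n)" using nucleusD(2)[OF g(1) hc nc] by (rule sym)
      also have "\<dots> = g \<otimes> (n \<otimes> h)" by (simp only: ch[OF n])
      also have "\<dots> = (g \<otimes> n) \<otimes> h" by (rule nucleusD(2)[OF g(1) nc hc])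
      also have "\<dots> = (n \<otimes> g) \<otimes> h" by (simp only: cg[OF n])
      also have "\<dots> = n \<otimes> (g \<otimes> h)" using nucleusD(2)[OF n gc hc] by (rule sym)
      finally show ?thesis .
    qed
    moreover have "g \<otimes> h \<in> nucleus Q"
      using g(1) h(1) by (rule mult_in_nucleus)
    ultimately show ?case unfolding mult by blast
  qed
  have "u \<otimes> u = \<one>" if "u \<in> generate (nucleus_group Q) (nucleus Q \<inter> associators Q)" for u
    using central[OF that] by blast
  then show ?thesis
    unfolding boolean_group_def
    by (simp add: N.group_subgroup_generated carrier_subgroup_generated carrier mult unit)
qed

section \<open>Translations and inner mappings as permutations\<close>

lemma left_translation_Bij:
  assumes "x \<in> carrier Q"
  shows "left_translation Q x \<in> Bij (carrier Q)"
proof -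
  have "bij_betw (left_translation Q x) (carrier Q) (carrier Q)"
    by (rule bij_betwI[where g = "\<lambda>y. inv x \<otimes> y"]) (use assms in \<open>auto simp: left_translation_def\<close>)
  then show ?thesis by (simp add: Bij_def left_translation_def)
qed

lemma right_translation_Bij:
  assumes "x \<in> carrier Q"
  shows "right_translation Q x \<in> Bij (carrier Q)"
proof -
  have "bij_betw (right_translation Q x) (carrier Q) (carrier Q)"
    by (rule bij_betwI[where g = "\<lambda>y. y \<otimes> inv x"]) (use assms in \<open>auto simp: right_translation_def\<close>)
  then show ?thesis by (simp add: Bij_def right_translation_def)
qed

lemma BijGroup_mult:
  "\<lbrakk>g \<in> Bij S; f \<in> Bij S\<rbrakk> \<Longrightarrow> g \<otimes>\<^bsub>BijGroup S\<^esub> f = compose S g f"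
  by (simp add: BijGroup_def)

lemma BijGroup_one: "\<one>\<^bsub>BijGroup S\<^esub> = (\<lambda>x\<in>S. x)"
  by (simp add: BijGroup_def)

lemma inv_left_translation:
  assumes "x \<in> carrier Q"
  shows "inv\<^bsub>BijGroup (carrier Q)\<^esub> (left_translation Q x) = left_translation Q (inv x)"
proof (rule group.inv_equality[OF group_BijGroup])
  show "left_translation Q (inv x) \<otimes>\<^bsub>BijGroup (carrier Q)\<^esub> left_translation Q x
      = \<one>\<^bsub>BijGroup (carrier Q)\<^esub>"
    using assms
    by (simp add: BijGroup_mult left_translation_Bij BijGroup_one)
      (auto simp: compose_def left_translation_def fun_eq_iff)
qed (use assms left_translation_Bij in \<open>auto simp: BijGroup_def\<close>)

lemma inv_right_translation:
  assumes "x \<in> carrier Q"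
  shows "inv\<^bsub>BijGroup (carrier Q)\<^esub> (right_translation Q x) = right_translation Q (inv x)"
proof (rule group.inv_equality[OF group_BijGroup])
  show "right_translation Q (inv x) \<otimes>\<^bsub>BijGroup (carrier Q)\<^esub> right_translation Q x
      = \<one>\<^bsub>BijGroup (carrier Q)\<^esub>"
    using assms
    by (simp add: BijGroup_mult right_translation_Bij BijGroup_one)
      (auto simp: compose_def right_translation_def fun_eq_iff)
qed (use assms right_translation_Bij in \<open>auto simp: BijGroup_def\<close>)

text \<open>Unfolding produces the map at \<open>y, x\<close>; its symmetry gives the order chosen
  here, which matches \<open>right_inner_eq\<close>.\<close>

lemma left_inner_eq:
  assumes "x \<in> carrier Q" "y \<in> carrier Q"
  shows "left_inner Q x y = (\<lambda>z \<in> carrier Q. left_assoc_map x y z)"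
  using assms left_assoc_map_commute[of y x]
  by (simp add: left_inner_def inv_left_translation BijGroup_mult left_translation_Bij compose_Bij)
    (auto simp: compose_def left_translation_def left_assoc_map_def fun_eq_iff)

lemma right_inner_eq:
  assumes "x \<in> carrier Q" "y \<in> carrier Q"
  shows "right_inner Q x y = (\<lambda>z \<in> carrier Q. left_assoc_map x y z)"
  using assms
  by (simp add: right_inner_def inv_right_translation BijGroup_mult right_translation_Bij compose_Bij)
    (auto simp: compose_def right_translation_def right_assoc_map_eq fun_eq_iff)

lemma left_inner_Bij:
  assumes "x \<in> carrier Q" "y \<in> carrier Q"
  shows "left_inner Q x y \<in> Bij (carrier Q)"
  using assms
  by (simp add: left_inner_def inv_left_translation BijGroup_mult left_translation_Bij compose_Bij)

lemma left_inner_square: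
  assumes "x \<in> carrier Q" "y \<in> carrier Q"
  shows "left_inner Q x y [^]\<^bsub>BijGroup (carrier Q)\<^esub> (2::nat) = \<one>\<^bsub>BijGroup (carrier Q)\<^esub>"
proof -
  interpret B: group "BijGroup (carrier Q)" by (rule group_BijGroup)
  let ?f = "left_inner Q x y"
  have mem: "?f \<in> carrier (BijGroup (carrier Q))"
    using left_inner_Bij[OF assms] by (simp add: BijGroup_def)
  have "?f [^]\<^bsub>BijGroup (carrier Q)\<^esub> (2::nat) = ?f \<otimes>\<^bsub>BijGroup (carrier Q)\<^esub> ?f"
    using mem by (simp add: numeral_2_eq_2)
  also have "\<dots> = compose (carrier Q) ?f ?f"
    using left_inner_Bij[OF assms] by (simp add: BijGroup_mult)
  also have "\<dots> = \<one>\<^bsub>BijGroup (carrier Q)\<^esub>"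
    unfolding left_inner_eq[OF assms] BijGroup_one compose_def
    using assms by (intro restrict_ext) (simp add: left_assoc_map_involution)
  finally show ?thesis .
qed

end

theorem theorem4p13:
  fixes Q :: "('a, 'b) monoid_scheme" (structure)
  assumes "extra_loop Q"
  shows
    "(\<forall>x \<in> carrier Q. \<forall>y \<in> carrier Q.
        left_inner Q x y = right_inner Q x y \<and>
        right_inner Q x y = left_inner Q y x \<and>
        left_inner Q y x = right_inner Q y x \<and>
        left_inner Q x y [^]\<^bsub>BijGroup (carrier Q)\<^esub> (2::nat) = \<one>\<^bsub>BijGroup (carrier Q)\<^esub>) \<and>
     (\<forall>x \<in> carrier Q. \<forall>y \<in> carrier Q. \<forall>z \<in> carrier Q.
        l_associator Q x y z = r_associator Q x y z \<and>
        l_associator Q x y z \<otimes> l_associator Q x y z = \<one>) \<and>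
     associators Q \<subseteq> nucleus Q \<and>
     boolean_group (subgroup_generated (nucleus_group Q) (associators Q)) \<and>
     (\<forall>x \<in> carrier Q. \<forall>y \<in> carrier Q. \<forall>z \<in> carrier Q.
        l_associator Q x y z \<otimes> x = x \<otimes> l_associator Q x y z \<and>
        l_associator Q x y z \<otimes> y = y \<otimes> l_associator Q x y z \<and>
        l_associator Q x y z \<otimes> z = z \<otimes> l_associator Q x y z)"
proof -
  interpret extra_loop Q by fact
  have left_right: "left_inner Q x y = right_inner Q x y"
    if "x \<in> carrier Q" "y \<in> carrier Q" for x y
    by (simp only: left_inner_eq[OF that] right_inner_eq[OF that])
  have right_left: "right_inner Q x y = left_inner Q y x"
    if "x \<in> carrier Q" "y \<in> carrier Q" for x y
    unfolding right_inner_eq[OF that] left_inner_eq[OF that(2,1)]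
    using left_assoc_map_commute[OF that] by (rule restrict_ext)
  show ?thesis
    by (intro conjI ballI left_right right_left left_inner_square r_associator_eq[symmetric]
        associator_square associators_subset_nucleus boolean_group_associators associator_commutes)
qed

end
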